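(* Let $A \subseteq \mathbb{N}$. If there exists an increasing sequence $(a_n)$ of elements of $A$ such that $a_{n-1}/a_n \to 1$ as $n \to +\infty$, then $D^k(A)$ is dense in $S^{k-1}$ for every integer $k \geq 2$.
   Context: $\mathbb{N}$ denotes the set of positive integers and $\|\cdot\|$ the Euclidean norm. "Increasing" means strictly increasing. For every integer $k \geq 2$, put $S^{k-1} := \{\boldsymbol{x} \in [0,1]^k : \|\boldsymbol{x}\| = 1\}$ (the part of the unit sphere of $\mathbb{R}^k$ with nonnegative coordinates), with the subspace topology from $\mathbb{R}^k$, and for $A \subseteq \mathbb{N}$ put $D^k(A) := \{\boldsymbol{a}/\|\boldsymbol{a}\| : \boldsymbol{a} \in A^k\} \subseteq S^{k-1}$. *)

theory Defs
  imports "HOL-Analysis.Analysis"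
begin

text \<open>
  The dimension \<open>k\<close> is \<open>CARD('k)\<close>, the cardinality of the finite index type; \<open>pos_sphere\<close> is
  the set written $S^{k-1}$, a subset of $\mathbf{R}^k$.
\<close>

definition pos_sphere :: "(real ^ 'k::finite) set" where
  "pos_sphere = {x. (\<forall>i. x $ i \<in> {0..1}) \<and> norm x = 1}"

definition direction_set :: "nat set \<Rightarrow> (real ^ 'k::finite) set" where
  "direction_set A = {a /\<^sub>R norm a | a. \<forall>i. a $ i \<in> real ` A}"

lemma direction_set_subset_pos_sphere:
  assumes "A \<subseteq> {0<..}"
  shows "direction_set A \<subseteq> (pos_sphere :: (real ^ 'k::finite) set)"
proof
  fix x :: "real ^ 'k"
  assume "x \<in> direction_set A"
  then obtain a :: "real ^ 'k" where x: "x = a /\<^sub>R norm a" and a: "\<And>i. a $ i \<in> real ` A"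
    by (auto simp: direction_set_def)
  have pos: "a $ i > 0" for i
    using a[of i] assms by auto
  have "a \<noteq> 0"
    using pos by (metis less_irrefl zero_index)
  then have "norm x = 1"
    by (simp add: x)
  moreover have "x $ i \<ge> 0" for i
    using pos[of i] by (simp add: x)
  moreover have "x $ i \<le> 1" for i
    using component_le_norm_cart[of x i] \<open>norm x = 1\<close> by linarith
  ultimately show "x \<in> pos_sphere"
    by (simp add: pos_sphere_def)
qed

end

theory Submission
  imports Defs
begin

text \<open>
  Rounding a real number \<open>t\<close> up to the next term of the sequence changes it by a factor tending to
  \<open>1\<close> as \<open>t\<close> tends to infinity. Rounding the coordinates of the dilated point \<open>n x\<close> therefore gives
  points \<open>v n\<close> of \<open>A\<^sup>k\<close> with \<open>v n / n\<close> tending to \<open>x\<close>, so their directions tend to \<open>x / norm x\<close>.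
\<close>

lemma exists_asymptotic_rounding:
  fixes a :: "nat \<Rightarrow> nat"
  assumes mono: "strict_mono a"
    and pos: "\<And>n. a n > 0"
    and lim: "(\<lambda>n. real (a n) / real (a (Suc n))) \<longlonglongrightarrow> 1"
  obtains f :: "real \<Rightarrow> real" where "\<And>t. f t \<in> real ` range a" "((\<lambda>t. f t / t) \<longlongrightarrow> 1) at_top"
proof -
  \<comment> \<open>Minimizing over \<open>Suc n\<close> instead of \<open>n\<close> ensures that
    the rounded value \<open>a (Suc (L t))\<close> always has a predecessor \<open>a (L t)\<close>.
    Every \<open>t\<close> up to \<open>a 0\<close> is then rounded to \<open>a 1\<close>, which is
    harmless in a limit at infinity.\<close>
  define L where "L t = (LEAST n. t \<le> real (a (Suc n)))" for t :: real
  have L_upper: "t \<le> real (a (Suc (L t)))" for t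
  proof -
    obtain n where "t \<le> real n"
      using real_arch_simple by blast
    also have "n \<le> a (Suc n)"
      using strict_mono_imp_increasing[OF mono, of "Suc n"] by simp
    finally have "t \<le> real (a (Suc n))"
      by simp
    then show ?thesis
      unfolding L_def by (rule LeastI)
  qed
  have L_lower: "real (a (L t)) < t" if "real (a 0) < t" for t
  proof (cases "L t")
    case (Suc m)
    then have "\<not> t \<le> real (a (Suc m))"
      using not_less_Least[of m "\<lambda>n. t \<le> real (a (Suc n))"] by (simp add: L_def)
    then show ?thesis
      by (simp add: Suc)
  qed (use that in simp)
  \<comment> \<open>Needed to turn the limit of consecutive ratios along the naturals into one along
    real \<open>t\<close>.\<close>
  have "filterlim L sequentially at_top"
    unfolding filterlim_at_top
  proof
    fix m
    show "eventually (\<lambda>t. m \<le> L t) at_top"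
      using eventually_gt_at_top[of "real (a m)"]
    proof eventually_elim
      case (elim t)
      then have "a m < a (Suc (L t))"
        using L_upper[of t] by linarith
      then show ?case
        by (simp add: strict_mono_less[OF mono])
    qed
  qed
  then have "((\<lambda>t. real (a (L t)) / real (a (Suc (L t)))) \<longlongrightarrow> 1) at_top"
    by (rule filterlim_compose[OF lim])
  \<comment> \<open>For large \<open>t\<close>, dividing
    \<open>a (L t) < t \<le> a (Suc (L t))\<close> by the upper bound squeezes the quotient between
    a consecutive ratio and 1.\<close>
  then have "((\<lambda>t. t / real (a (Suc (L t)))) \<longlongrightarrow> 1) at_top"
  proof (rule real_tendsto_sandwich[rotated 2])
    show "eventually (\<lambda>t. real (a (L t)) / real (a (Suc (L t))) \<le> t / real (a (Suc (L t)))) at_top"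
      using eventually_gt_at_top[of "real (a 0)"]
    proof eventually_elim
      case (elim t)
      show ?case
        by (rule divide_right_mono[OF less_imp_le[OF L_lower[OF elim]] of_nat_0_le_iff])
    qed
    show "eventually (\<lambda>t. t / real (a (Suc (L t))) \<le> 1) at_top"
      using L_upper pos by (simp add: divide_le_eq)
  qed simp
  from tendsto_inverse[OF this] have "((\<lambda>t. real (a (Suc (L t))) / t) \<longlongrightarrow> 1) at_top"
    by simp
  then show ?thesis
    by (intro that[of "\<lambda>t. real (a (Suc (L t)))"]) auto
qed

text \<open>For \<open>y > 0\<close> the argument \<open>n * y\<close> tends to infinity, so the
  limit of \<open>f t / t\<close> applies and is multiplied by \<open>y\<close>. For
  \<open>y = 0\<close> the numerator is the constant \<open>f 0\<close>; this case covers points of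
  the sphere with vanishing coordinates.\<close>

lemma tendsto_rounded_multiple:
  fixes f :: "real \<Rightarrow> real"
  assumes "((\<lambda>t. f t / t) \<longlongrightarrow> 1) at_top" "0 \<le> y"
  shows "(\<lambda>n. f (real n * y) / real n) \<longlonglongrightarrow> y"
proof (cases "y = 0")
  case True
  then show ?thesis
    by (simp add: lim_const_over_n)
next
  case False
  with assms(2) have "y > 0"
    by simp
  then have "filterlim (\<lambda>n. real n * y) at_top sequentially"
    by (intro filterlim_at_top_mult_tendsto_pos[OF tendsto_const] filterlim_real_sequentially)
  then have "(\<lambda>n. f (real n * y) / (real n * y)) \<longlonglongrightarrow> 1"
    by (rule filterlim_compose[OF assms(1)])
  from tendsto_mult_right[OF this, of y] show ?thesis
    using \<open>y > 0\<close> by simp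
qed

theorem theorem1p5:
  fixes A :: "nat set"
  assumes "A \<subseteq> {0<..}"
    and "\<exists>a :: nat \<Rightarrow> nat. strict_mono a \<and> range a \<subseteq> A \<and>
           (\<lambda>n. real (a n) / real (a (Suc n))) \<longlonglongrightarrow> 1"
    and "CARD('k::finite) \<ge> 2"
  shows "top_of_set pos_sphere closure_of direction_set A = (pos_sphere :: (real ^ 'k) set)"
proof -
  obtain a :: "nat \<Rightarrow> nat" where a: "strict_mono a" "range a \<subseteq> A"
    "(\<lambda>n. real (a n) / real (a (Suc n))) \<longlonglongrightarrow> 1"
    using assms(2) by blast
  have pos: "a n > 0" for n
    using a(2) assms(1) by auto
  obtain f where f: "\<And>t. f t \<in> real ` range a" "((\<lambda>t. f t / t) \<longlongrightarrow> 1) at_top"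
    using exists_asymptotic_rounding[OF a(1) pos a(3)] by blast
  have "x \<in> closure (direction_set A)" if x: "x \<in> pos_sphere" for x :: "real ^ 'k"
  proof -
    define v :: "nat \<Rightarrow> real ^ 'k" where "v n = (\<chi> i. f (real n * x $ i))" for n
    have v: "v n /\<^sub>R norm (v n) \<in> direction_set A" for n
      using f(1) a(2) unfolding direction_set_def v_def by fastforce
    have lim: "(\<lambda>n. v n /\<^sub>R real n) \<longlonglongrightarrow> x"
    proof (rule vec_tendstoI)
      fix i
      show "(\<lambda>n. (v n /\<^sub>R real n) $ i) \<longlonglongrightarrow> x $ i"
        using tendsto_rounded_multiple[OF f(2), of "x $ i"] x
        by (simp add: v_def pos_sphere_def divide_inverse mult.commute)
    qed
    have norm_x: "norm x = 1"
      using x by (simp add: pos_sphere_def)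
    \<comment> \<open>Normalization is continuous at \<open>x\<close>, since
      \<open>norm x = 1\<close> is nonzero.\<close>
    have "(\<lambda>n. (v n /\<^sub>R real n) /\<^sub>R norm (v n /\<^sub>R real n)) \<longlonglongrightarrow> x /\<^sub>R norm x"
      using norm_x by (intro tendsto_intros lim) auto
    \<comment> \<open>A positive scaling does not change the direction; at \<open>n = 0\<close> the
      scaled vector is 0, so the equality is only claimed eventually.\<close>
    moreover have "eventually (\<lambda>n. (v n /\<^sub>R real n) /\<^sub>R norm (v n /\<^sub>R real n) = v n /\<^sub>R norm (v n))
        sequentially"
      using eventually_gt_at_top[of 0] by eventually_elim simp
    ultimately have "(\<lambda>n. v n /\<^sub>R norm (v n)) \<longlonglongrightarrow> x /\<^sub>R norm x"
      by (rule Lim_transform_eventually)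
    then have "(\<lambda>n. v n /\<^sub>R norm (v n)) \<longlonglongrightarrow> x"
      by (simp add: norm_x)
    then show ?thesis
      unfolding closure_sequential using v by (intro exI conjI allI)
  qed
  then have "pos_sphere \<inter> closure (direction_set A) = (pos_sphere :: (real ^ 'k) set)"
    by blast
  moreover have "pos_sphere \<inter> direction_set A = (direction_set A :: (real ^ 'k) set)"
    using direction_set_subset_pos_sphere[OF assms(1)] by blast
  \<comment> \<open>The closure of a set in a subspace is the trace on the subspace of the ambient
    closure of the set's own trace; the two preceding facts compute the outer and the inner
    intersection.\<close>
  ultimately show ?thesis
    by (simp only: closure_of_subtopology euclidean_closure_of)
qed

end
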